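(* Let $R$ be a $2$-primal ring and let $\alpha$ be a ring endomorphism of $R$. If $R$ is $\alpha$-compatible, then the following four statements are equivalent: (1) $R$ is a $UU$ ring. (2) $R[x;\alpha]$ is a $UJ^{\#}$ ring. (3) $R[x;\alpha]$ is a $UJ$ ring. (4) $R[x;\alpha]$ is a $UU$ ring.
   Context: All rings are associative with identity. $J(R)$ is the Jacobson radical, $U(R)$ the group of units and $Nil(R)$ the set of nilpotent elements of $R$. Define $J^{\#}(R)=\{z\in R : z^n\in J(R)\text{ for some } n\ge 1\}$. A ring $R$ is a $UJ^{\#}$ ring if $U(R)=1+J^{\#}(R)$, a $UJ$ ring if $U(R)=1+J(R)$, and a $UU$ ring if $U(R)=1+Nil(R)$. $Nil_*(R)$ denotes the prime radical (intersection of all prime ideals); $R$ is $2$-primal if $Nil(R)=Nil_*(R)$. $R$ is $\alpha$-compatible if for all $a,b\in R$: $ab=0$ if and only if $a\alpha(b)=0$. $R[x;\alpha]$ is the ring of skew polynomials over $R$, with coefficients written on the left and multiplication determined by $xr=\alpha(r)x$ for $r\in R$. *)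

theory Defs
  imports "HOL-Algebra.UnivPoly" "HOL-Algebra.Ideal_Product"
begin

section \<open>Radicals and unit conditions for rings that need not be commutative\<close>

definition left_ideal :: "'a set \<Rightarrow> ('a, 'b) ring_scheme \<Rightarrow> bool" where
  "left_ideal I R \<longleftrightarrow> additive_subgroup I R \<and> (\<forall>r\<in>carrier R. \<forall>x\<in>I. r \<otimes>\<^bsub>R\<^esub> x \<in> I)"

definition maximal_left_ideal :: "'a set \<Rightarrow> ('a, 'b) ring_scheme \<Rightarrow> bool" where
  "maximal_left_ideal M R \<longleftrightarrow> left_ideal M R \<and> M \<noteq> carrier R \<and>
     (\<forall>I. left_ideal I R \<longrightarrow> M \<subseteq> I \<longrightarrow> I = M \<or> I = carrier R)"

text \<open>An intersection over no ideals (zero ring) is the whole carrier, here and for the prime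
  radical.\<close>

definition jacobson_radical :: "('a, 'b) ring_scheme \<Rightarrow> 'a set" where
  "jacobson_radical R = {x \<in> carrier R. \<forall>M. maximal_left_ideal M R \<longrightarrow> x \<in> M}"

definition J_sharp :: "('a, 'b) ring_scheme \<Rightarrow> 'a set" where
  "J_sharp R = {z \<in> carrier R. \<exists>n::nat. n \<ge> 1 \<and> z [^]\<^bsub>R\<^esub> n \<in> jacobson_radical R}"

definition nilpotents :: "('a, 'b) ring_scheme \<Rightarrow> 'a set" where
  "nilpotents R = {z \<in> carrier R. \<exists>n::nat. n \<ge> 1 \<and> z [^]\<^bsub>R\<^esub> n = \<zero>\<^bsub>R\<^esub>}"

text \<open>The library's \<^locale>\<open>primeideal\<close> presupposes a commutative ring and is element-wise; for
  general rings primeness refers to products of two-sided ideals.\<close>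

definition nc_prime_ideal :: "'a set \<Rightarrow> ('a, 'b) ring_scheme \<Rightarrow> bool" where
  "nc_prime_ideal P R \<longleftrightarrow> ideal P R \<and> P \<noteq> carrier R \<and>
     (\<forall>I J. ideal I R \<longrightarrow> ideal J R \<longrightarrow> I \<cdot>\<^bsub>R\<^esub> J \<subseteq> P \<longrightarrow> I \<subseteq> P \<or> J \<subseteq> P)"

definition prime_radical :: "('a, 'b) ring_scheme \<Rightarrow> 'a set" where
  "prime_radical R = {x \<in> carrier R. \<forall>P. nc_prime_ideal P R \<longrightarrow> x \<in> P}"

definition two_primal :: "('a, 'b) ring_scheme \<Rightarrow> bool" where
  "two_primal R \<longleftrightarrow> nilpotents R = prime_radical R"

definition UU_ring :: "('a, 'b) ring_scheme \<Rightarrow> bool" where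
  "UU_ring R \<longleftrightarrow> Units R = \<one>\<^bsub>R\<^esub> <+\<^bsub>R\<^esub> nilpotents R"

definition UJ_ring :: "('a, 'b) ring_scheme \<Rightarrow> bool" where
  "UJ_ring R \<longleftrightarrow> Units R = \<one>\<^bsub>R\<^esub> <+\<^bsub>R\<^esub> jacobson_radical R"

definition UJ_sharp_ring :: "('a, 'b) ring_scheme \<Rightarrow> bool" where
  "UJ_sharp_ring R \<longleftrightarrow> Units R = \<one>\<^bsub>R\<^esub> <+\<^bsub>R\<^esub> J_sharp R"

definition compatible :: "('a, 'b) ring_scheme \<Rightarrow> ('a \<Rightarrow> 'a) \<Rightarrow> bool" where
  "compatible R \<alpha> \<longleftrightarrow> (\<forall>a\<in>carrier R. \<forall>b\<in>carrier R.
     a \<otimes>\<^bsub>R\<^esub> b = \<zero>\<^bsub>R\<^esub> \<longleftrightarrow> a \<otimes>\<^bsub>R\<^esub> \<alpha> b = \<zero>\<^bsub>R\<^esub>)"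


section \<open>Skew polynomial rings\<close>

text \<open>\<^term>\<open>skew_UP R \<alpha>\<close> is the ring of polynomials with coefficients on the left and
  \<open>x r = \<alpha>(r) x\<close>. It differs from \<^const>\<open>UP\<close> only in its multiplication, which is forced by
  \<open>(a x\<^sup>i)(b x\<^sup>j) = a \<alpha>\<^sup>i(b) x\<^sup>i\<^sup>+\<^sup>j\<close>.\<close>

definition skew_UP :: "('a, 'b) ring_scheme \<Rightarrow> ('a \<Rightarrow> 'a) \<Rightarrow> ('a, nat \<Rightarrow> 'a) up_ring" where
  "skew_UP R \<alpha> = (UP R)\<lparr>mult := (\<lambda>p\<in>up R. \<lambda>q\<in>up R. \<lambda>n.
     \<Oplus>\<^bsub>R\<^esub>i\<in>{..n}. p i \<otimes>\<^bsub>R\<^esub> (\<alpha> ^^ i) (q (n - i)))\<rparr>"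

lemma skew_UP_simps:
  "carrier (skew_UP R \<alpha>) = up R"
  "\<one>\<^bsub>skew_UP R \<alpha>\<^esub> = (\<lambda>i. if i = 0 then \<one>\<^bsub>R\<^esub> else \<zero>\<^bsub>R\<^esub>)"
  "\<zero>\<^bsub>skew_UP R \<alpha>\<^esub> = (\<lambda>i. \<zero>\<^bsub>R\<^esub>)"
  "\<lbrakk>p \<in> up R; q \<in> up R\<rbrakk> \<Longrightarrow> p \<oplus>\<^bsub>skew_UP R \<alpha>\<^esub> q = (\<lambda>i. p i \<oplus>\<^bsub>R\<^esub> q i)"
  "\<lbrakk>p \<in> up R; q \<in> up R\<rbrakk> \<Longrightarrow> p \<otimes>\<^bsub>skew_UP R \<alpha>\<^esub> q =
     (\<lambda>n. \<Oplus>\<^bsub>R\<^esub>i\<in>{..n}. p i \<otimes>\<^bsub>R\<^esub> (\<alpha> ^^ i) (q (n - i)))"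
  "a \<in> carrier R \<Longrightarrow> monom (skew_UP R \<alpha>) a n = (\<lambda>i. if i = n then a else \<zero>\<^bsub>R\<^esub>)"
  by (simp_all add: skew_UP_def UP_def)

lemma funpow_ring_hom:
  assumes "\<alpha> \<in> ring_hom R R"
  shows "\<alpha> ^^ n \<in> ring_hom R R"
proof (induction n)
  case 0
  show ?case by (simp add: ring_hom_def Pi_def)
next
  case (Suc n)
  from ring_hom_trans[OF this assms] show ?case by (simp add: comp_def)
qed

lemma (in ring) monom_up: "a \<in> carrier R \<Longrightarrow> (\<lambda>i. if i = n then a else \<zero>) \<in> up R"
  by (auto simp: up_def)

lemma (in ring) zero_up: "(\<lambda>i. \<zero>) \<in> up R"
  by (auto simp: up_def)

lemma (in ring) finsum_hom:
  assumes "h \<in> ring_hom R R" "finite A" "f \<in> A \<rightarrow> carrier R"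
  shows "h (\<Oplus>i\<in>A. f i) = (\<Oplus>i\<in>A. h (f i))"
proof -
  interpret ring_hom_ring R R h
    by (rule ring_hom_ringI2) (use assms ring_axioms in auto)
  show ?thesis using assms hom_finsum[of f A] by (simp add: comp_def)
qed

lemma (in ring) skew_UP_is_ring:
  assumes \<alpha>: "\<alpha> \<in> ring_hom R R"
  shows "ring (skew_UP R \<alpha>)"
proof -
  let ?S = "skew_UP R \<alpha>"
  have hom: "\<alpha> ^^ n \<in> ring_hom R R" for n by (rule funpow_ring_hom[OF \<alpha>])
  have [simp]: "(\<alpha> ^^ n) a \<in> carrier R" if "a \<in> carrier R" for n a
    using ring_hom_closed[OF hom that] .
  have h0 [simp]: "(\<alpha> ^^ n) \<zero> = \<zero>" for n
    using ring_hom_zero[OF hom] ring_axioms by blast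
  have h1: "(\<alpha> ^^ n) \<one> = \<one>" for n using ring_hom_one[OF hom] .
  have hadd: "(\<alpha> ^^ n) (a \<oplus> b) = (\<alpha> ^^ n) a \<oplus> (\<alpha> ^^ n) b"
    if "a \<in> carrier R" "b \<in> carrier R" for n a b using ring_hom_add[OF hom that] .
  have hmult: "(\<alpha> ^^ n) (a \<otimes> b) = (\<alpha> ^^ n) a \<otimes> (\<alpha> ^^ n) b"
    if "a \<in> carrier R" "b \<in> carrier R" for n a b using ring_hom_mult[OF hom that] .
  note up [simp] = mem_upD[of _ R]
  have mcl: "p \<otimes>\<^bsub>?S\<^esub> q \<in> up R" if "p \<in> up R" "q \<in> up R" for p q
  proof -
    from that obtain n where n: "bound \<zero> n p" by fast
    from that obtain m where m: "bound \<zero> m q" by fast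
    have "bound \<zero> (n + m) (p \<otimes>\<^bsub>?S\<^esub> q)"
    proof
      fix k assume k: "n + m < k"
      have "p i \<otimes> (\<alpha> ^^ i) (q (k - i)) = \<zero>" for i
      proof (cases "n < i")
        case True
        then have "p i = \<zero>" using n by auto
        then show ?thesis using that by simp
      next
        case False
        then have "m < k - i" using k by arith
        then have "q (k - i) = \<zero>" using m by auto
        then show ?thesis using that by simp
      qed
      then show "(p \<otimes>\<^bsub>?S\<^esub> q) k = \<zero>" using that by (simp add: skew_UP_simps Pi_def)
    qed
    then show ?thesis using that
      by (intro mem_upI) (auto simp: skew_UP_simps intro!: finsum_closed)
  qed
  have assoc: "(p \<otimes>\<^bsub>?S\<^esub> q) \<otimes>\<^bsub>?S\<^esub> r = p \<otimes>\<^bsub>?S\<^esub> (q \<otimes>\<^bsub>?S\<^esub> r)"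
    if pqr: "p \<in> up R" "q \<in> up R" "r \<in> up R" for p q r
  proof
    fix n
    have aux: "(\<Oplus>j\<in>{..k}. (\<Oplus>i\<in>{..j}. a i \<otimes> B i (j - i)) \<otimes> C j) =
               (\<Oplus>j\<in>{..k}. a j \<otimes> (\<Oplus>i\<in>{..k - j}. B j i \<otimes> C (j + i)))"
      if "a \<in> UNIV \<rightarrow> carrier R" "\<And>i. B i \<in> UNIV \<rightarrow> carrier R" "C \<in> UNIV \<rightarrow> carrier R"
      for a C :: "nat \<Rightarrow> 'a" and B k
    proof (induction k)
      case 0
      then show ?case using that by (simp add: Pi_def m_assoc)
    next
      case (Suc k)
      then show ?case using that
        by (simp cong: finsum_cong add: Suc_diff_le Pi_def l_distr r_distr m_assoc)
           (simp cong: finsum_cong add: Pi_def a_ac finsum_ldistr m_assoc)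
    qed
    have "((p \<otimes>\<^bsub>?S\<^esub> q) \<otimes>\<^bsub>?S\<^esub> r) n =
      (\<Oplus>j\<in>{..n}. (\<Oplus>i\<in>{..j}. p i \<otimes> (\<alpha> ^^ i) (q (j - i))) \<otimes> (\<alpha> ^^ j) (r (n - j)))"
      using pqr mcl[OF pqr(1,2)] by (simp add: skew_UP_simps)
    also have "\<dots> = (\<Oplus>j\<in>{..n}. p j \<otimes>
        (\<Oplus>i\<in>{..n - j}. (\<alpha> ^^ j) (q i) \<otimes> (\<alpha> ^^ (j + i)) (r (n - (j + i)))))"
      using pqr by (intro aux) auto
    also have "\<dots> = (\<Oplus>j\<in>{..n}. p j \<otimes>
        (\<alpha> ^^ j) (\<Oplus>i\<in>{..n - j}. q i \<otimes> (\<alpha> ^^ i) (r (n - j - i))))"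
      using pqr
      by (simp cong: finsum_cong add: Pi_def finsum_hom[OF hom] hmult funpow_add)
    also have "\<dots> = (p \<otimes>\<^bsub>?S\<^esub> (q \<otimes>\<^bsub>?S\<^esub> r)) n"
      using pqr mcl[OF pqr(2,3)] by (simp add: skew_UP_simps)
    finally show "((p \<otimes>\<^bsub>?S\<^esub> q) \<otimes>\<^bsub>?S\<^esub> r) n = (p \<otimes>\<^bsub>?S\<^esub> (q \<otimes>\<^bsub>?S\<^esub> r)) n" .
  qed
  show ?thesis
  proof (rule ringI)
    show "abelian_group ?S"
    proof (rule abelian_groupI)
      fix p assume "p \<in> carrier ?S"
      then show "\<exists>q\<in>carrier ?S. q \<oplus>\<^bsub>?S\<^esub> p = \<zero>\<^bsub>?S\<^esub>"
        by (intro bexI[of _ "\<lambda>i. \<ominus> p i"]) (auto simp: skew_UP_simps up_a_inv_closed l_neg)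
    qed (auto simp: skew_UP_simps up_add_closed zero_up a_ac)
    show "monoid ?S"
    proof (rule monoidI)
      fix p assume p: "p \<in> carrier ?S"
      show "\<one>\<^bsub>?S\<^esub> \<otimes>\<^bsub>?S\<^esub> p = p"
      proof
        fix n
        have "(\<one>\<^bsub>?S\<^esub> \<otimes>\<^bsub>?S\<^esub> p) n = (\<Oplus>i\<in>{..n}. if 0 = i then p n else \<zero>)"
          using p up_one_closed
          by (simp only: skew_UP_simps) (intro finsum_cong', auto)
        also have "\<dots> = p n" using p add.finprod_singleton[of 0 "{..n}" "\<lambda>_. p n"]
          by (auto simp: skew_UP_simps)
        finally show "(\<one>\<^bsub>?S\<^esub> \<otimes>\<^bsub>?S\<^esub> p) n = p n" .
      qed
      show "p \<otimes>\<^bsub>?S\<^esub> \<one>\<^bsub>?S\<^esub> = p"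
      proof
        fix n
        have "(p \<otimes>\<^bsub>?S\<^esub> \<one>\<^bsub>?S\<^esub>) n = (\<Oplus>i\<in>{..n}. if n = i then p i else \<zero>)"
          using p up_one_closed
          by (simp only: skew_UP_simps) (intro finsum_cong', auto simp: h1)
        also have "\<dots> = p n" using p add.finprod_singleton[of n "{..n}" p]
          by (auto simp: skew_UP_simps)
        finally show "(p \<otimes>\<^bsub>?S\<^esub> \<one>\<^bsub>?S\<^esub>) n = p n" .
      qed
    qed (use mcl assoc in \<open>auto simp: skew_UP_simps(1) up_one_closed skew_UP_simps(2)\<close>)
  next
    fix p q r assume pqr: "p \<in> carrier ?S" "q \<in> carrier ?S" "r \<in> carrier ?S"
    then have pqr': "p \<in> up R" "q \<in> up R" "r \<in> up R" by (simp_all add: skew_UP_simps)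
    show "(p \<oplus>\<^bsub>?S\<^esub> q) \<otimes>\<^bsub>?S\<^esub> r = p \<otimes>\<^bsub>?S\<^esub> r \<oplus>\<^bsub>?S\<^esub> q \<otimes>\<^bsub>?S\<^esub> r"
    proof
      fix n
      show "((p \<oplus>\<^bsub>?S\<^esub> q) \<otimes>\<^bsub>?S\<^esub> r) n = (p \<otimes>\<^bsub>?S\<^esub> r \<oplus>\<^bsub>?S\<^esub> q \<otimes>\<^bsub>?S\<^esub> r) n"
        using pqr' up_add_closed[OF pqr'(1,2)] mcl[OF pqr'(1,3)] mcl[OF pqr'(2,3)]
        by (simp add: skew_UP_simps l_distr finsum_addf Pi_def cong: finsum_cong)
    qed
    show "r \<otimes>\<^bsub>?S\<^esub> (p \<oplus>\<^bsub>?S\<^esub> q) = r \<otimes>\<^bsub>?S\<^esub> p \<oplus>\<^bsub>?S\<^esub> r \<otimes>\<^bsub>?S\<^esub> q"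
    proof
      fix n
      show "(r \<otimes>\<^bsub>?S\<^esub> (p \<oplus>\<^bsub>?S\<^esub> q)) n = (r \<otimes>\<^bsub>?S\<^esub> p \<oplus>\<^bsub>?S\<^esub> r \<otimes>\<^bsub>?S\<^esub> q) n"
        using pqr' up_add_closed[OF pqr'(1,2)] mcl[OF pqr'(3,1)] mcl[OF pqr'(3,2)]
        by (simp add: skew_UP_simps r_distr hadd finsum_addf Pi_def cong: finsum_cong)
    qed
  qed
qed

lemma (in ring) skew_UP_monom_mult:
  assumes \<alpha>: "\<alpha> \<in> ring_hom R R" and ab: "a \<in> carrier R" "b \<in> carrier R"
  shows "monom (skew_UP R \<alpha>) a i \<otimes>\<^bsub>skew_UP R \<alpha>\<^esub> monom (skew_UP R \<alpha>) b j =
         monom (skew_UP R \<alpha>) (a \<otimes> (\<alpha> ^^ i) b) (i + j)"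
proof
  fix n
  have cl: "(\<alpha> ^^ k) c \<in> carrier R" if "c \<in> carrier R" for k c
    using ring_hom_closed[OF funpow_ring_hom[OF \<alpha>] that] .
  have h0: "(\<alpha> ^^ k) \<zero> = \<zero>" for k
    using ring_hom_zero[OF funpow_ring_hom[OF \<alpha>]] ring_axioms by blast
  have "(monom (skew_UP R \<alpha>) a i \<otimes>\<^bsub>skew_UP R \<alpha>\<^esub> monom (skew_UP R \<alpha>) b j) n =
      (\<Oplus>k\<in>{..n}. if i = k then (if n = i + j then a \<otimes> (\<alpha> ^^ i) b else \<zero>) else \<zero>)"
  proof -
    have "(if k = i then a else \<zero>) \<otimes> (\<alpha> ^^ k) (if n - k = j then b else \<zero>) =
        (if i = k then (if n = i + j then a \<otimes> (\<alpha> ^^ i) b else \<zero>) else \<zero>)" if "k \<le> n" for k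
      using that ab cl h0 by (cases "k = i"; cases "n - k = j") auto
    then show ?thesis
      using ab cl by (simp only: skew_UP_simps monom_up) (intro finsum_cong', auto)
  qed
  also have "\<dots> = (if n = i + j then a \<otimes> (\<alpha> ^^ i) b else \<zero>)"
  proof (cases "i \<le> n")
    case True
    then show ?thesis using ab cl add.finprod_singleton[of i "{..n}"
        "\<lambda>_. if n = i + j then a \<otimes> (\<alpha> ^^ i) b else \<zero>"] by auto
  next
    case False
    then have "(\<Oplus>k\<in>{..n}. if i = k then (if n = i + j then a \<otimes> (\<alpha> ^^ i) b else \<zero>) else \<zero>)
        = (\<Oplus>k\<in>{..n}. \<zero>)" using ab cl by (intro finsum_cong') auto
    then show ?thesis using False by simp
  qed
  finally show "(monom (skew_UP R \<alpha>) a i \<otimes>\<^bsub>skew_UP R \<alpha>\<^esub> monom (skew_UP R \<alpha>) b j) n =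
      monom (skew_UP R \<alpha>) (a \<otimes> (\<alpha> ^^ i) b) (i + j) n"
    using ab cl by (simp add: skew_UP_simps)
qed

end

theory Submission
  imports Defs "HOL-Algebra.Ring_Divisibility"
begin

text \<open>Write \<open>N = Nil(R)\<close>, an ideal because \<open>R\<close> is 2-primal, and \<open>S = R[x;\<alpha>]\<close>. Finite subsets of
  the prime radical generate nilpotent subrings, and by compatibility inserting powers of
  \<open>\<alpha>\<close> into a product does not affect whether it vanishes; hence \<open>N[x;\<alpha>]\<close> is a nil left ideal
  of \<open>S\<close> and lies in both \<open>Nil(S)\<close> and \<open>J(S)\<close>. As \<open>R/N\<close> is reduced, the units of \<open>S\<close> have a unit
  of \<open>R\<close> as constant term and all other coefficients in \<open>N\<close>. Conversely, a constant
  \<open>c \<in> J\<^sup>#(S)\<close> is nilpotent, since \<open>c\<^sup>k \<in> J(S)\<close> makes \<open>1 + x c\<^sup>k\<close> a unit. So \<open>R\<close> is UU iff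
  \<open>U(S) = 1 + X\<close>, for every \<open>X\<close> between \<open>N[x;\<alpha>]\<close> and \<open>J\<^sup>#(S)\<close>; the three ring conditions on \<open>S\<close> are
  the cases \<open>X = J\<^sup>#(S), J(S), Nil(S)\<close>.\<close>

section \<open>The Jacobson radical\<close>

lemma (in monoid) UnitsI_inverses:
  assumes "x \<in> carrier G" "l \<in> carrier G" "r \<in> carrier G"
    and "l \<otimes> x = \<one>" "x \<otimes> r = \<one>"
  shows "x \<in> Units G"
proof -
  have "l = r" using assms by (metis l_one m_assoc r_one)
  then show ?thesis using assms unfolding Units_def by auto
qed

context ring
begin

text \<open>Negatives are left multiples by \<open>\<ominus> \<one>\<close>, so the subgroup
  property follows from the closure conditions.\<close>

lemma left_idealI:
  assumes "I \<subseteq> carrier R" "\<zero> \<in> I"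
    and "\<And>x y. \<lbrakk>x \<in> I; y \<in> I\<rbrakk> \<Longrightarrow> x \<oplus> y \<in> I"
    and mult: "\<And>r x. \<lbrakk>r \<in> carrier R; x \<in> I\<rbrakk> \<Longrightarrow> r \<otimes> x \<in> I"
  shows "left_ideal I R"
proof -
  have "\<ominus> x \<in> I" if "x \<in> I" for x
    using mult[of "\<ominus> \<one>" x] that assms(1) by (simp add: l_minus subset_iff)
  then have "additive_subgroup I R"
    using assms by (intro additive_subgroup.intro add.subgroupI) (auto simp: a_inv_def)
  then show ?thesis using mult by (simp add: left_ideal_def)
qed

lemma left_idealD:
  assumes "left_ideal I R"
  shows "x \<in> I \<Longrightarrow> x \<in> carrier R" "\<zero> \<in> I"
    and "\<lbrakk>x \<in> I; y \<in> I\<rbrakk> \<Longrightarrow> x \<oplus> y \<in> I"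
    and "\<lbrakk>r \<in> carrier R; x \<in> I\<rbrakk> \<Longrightarrow> r \<otimes> x \<in> I"
    and "x \<in> I \<Longrightarrow> \<ominus> x \<in> I"
proof -
  interpret additive_subgroup I R using assms by (simp add: left_ideal_def)
  show mem: "x \<in> I \<Longrightarrow> x \<in> carrier R" "\<zero> \<in> I"
    "\<lbrakk>x \<in> I; y \<in> I\<rbrakk> \<Longrightarrow> x \<oplus> y \<in> I" by auto
  show mult: "\<And>r x. \<lbrakk>r \<in> carrier R; x \<in> I\<rbrakk> \<Longrightarrow> r \<otimes> x \<in> I"
    using assms by (simp add: left_ideal_def)
  show "x \<in> I \<Longrightarrow> \<ominus> x \<in> I" using mult[of "\<ominus> \<one>" x] mem(1) by (simp add: l_minus)
qed

lemma left_ideal_eq_carrier: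
  assumes "left_ideal I R" "u \<in> Units R" "u \<in> I"
  shows "I = carrier R"
proof -
  have "r \<in> I" if "r \<in> carrier R" for r
    using left_idealD(4)[OF assms(1), of "r \<otimes> inv u" u] assms(2,3) that
    by (simp add: m_assoc Units_closed)
  then show ?thesis using left_idealD(1)[OF assms(1)] by blast
qed

text \<open>This is \<open>M\<close> + \<open>R\<close> \<open>x\<close>. It is used with
  \<open>M\<close> zero, for a principal left ideal, and with \<open>M\<close> maximal, to enlarge
  it by an element.\<close>

lemma left_ideal_add_principal:
  assumes M: "left_ideal M R" and x: "x \<in> carrier R"
  shows "left_ideal {m \<oplus> r \<otimes> x | m r. m \<in> M \<and> r \<in> carrier R} R" (is "left_ideal ?I R")
proof (rule left_idealI)
  note MD = left_idealD[OF M]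
  show "?I \<subseteq> carrier R" using MD(1) x by auto
  have "\<zero> = \<zero> \<oplus> \<zero> \<otimes> x" using x by simp
  then show "\<zero> \<in> ?I" using MD(2) by blast
  fix y assume "y \<in> ?I"
  then obtain m r where y: "y = m \<oplus> r \<otimes> x" "m \<in> M" "r \<in> carrier R" by auto
  show "y \<oplus> z \<in> ?I" if "z \<in> ?I" for z
  proof -
    from that obtain m' r' where z: "z = m' \<oplus> r' \<otimes> x" "m' \<in> M" "r' \<in> carrier R" by auto
    have "y \<oplus> z = (m \<oplus> m') \<oplus> (r \<oplus> r') \<otimes> x"
      using y z x MD(1) by (simp add: l_distr a_ac)
    then show ?thesis using y z MD(3) by blast
  qed
  show "s \<otimes> y \<in> ?I" if s: "s \<in> carrier R" for s
  proof -
    have "s \<otimes> y = s \<otimes> m \<oplus> (s \<otimes> r) \<otimes> x" using y s x MD(1) by (simp add: r_distr m_assoc)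
    then show ?thesis using y s MD(4) by blast
  qed
qed

lemma left_ideal_chain_Union:
  assumes "C \<noteq> {}" "\<And>I. I \<in> C \<Longrightarrow> left_ideal I R" "\<And>I J. \<lbrakk>I \<in> C; J \<in> C\<rbrakk> \<Longrightarrow> I \<subseteq> J \<or> J \<subseteq> I"
  shows "left_ideal (\<Union>C) R"
proof (rule left_idealI)
  show "\<Union>C \<subseteq> carrier R" using left_idealD(1) assms(2) by blast
  show "\<zero> \<in> \<Union>C" using left_idealD(2) assms(1,2) by blast
  show "r \<otimes> x \<in> \<Union>C" if "r \<in> carrier R" "x \<in> \<Union>C" for r x
    using left_idealD(4) assms(2) that by blast
  show "x \<oplus> y \<in> \<Union>C" if "x \<in> \<Union>C" "y \<in> \<Union>C" for x y
  proof -
    from that obtain I J where IJ: "I \<in> C" "x \<in> I" "J \<in> C" "y \<in> J" by auto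
    then obtain K where "K \<in> C" "x \<in> K" "y \<in> K" using assms(3)[of I J] by blast
    then show ?thesis using left_idealD(3) assms(2) by blast
  qed
qed

lemma exists_maximal_left_ideal:
  assumes I: "left_ideal I R" and one: "\<one> \<notin> I"
  obtains M where "maximal_left_ideal M R" "I \<subseteq> M"
proof -
  \<comment> \<open>Properness is phrased as avoiding \<open>\<one>\<close>, a condition that passes
    directly to unions of chains.\<close>
  define F where "F = {L. left_ideal L R \<and> I \<subseteq> L \<and> \<one> \<notin> L}"
  have "\<exists>M\<in>F. \<forall>X\<in>F. M \<subseteq> X \<longrightarrow> X = M"
  proof (rule subset_Zorn_nonempty)
    show "F \<noteq> {}" using I one by (auto simp: F_def)
    fix C assume C: "C \<noteq> {}" "subset.chain F C"
    then have "left_ideal (\<Union>C) R"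
      by (intro left_ideal_chain_Union) (auto simp: F_def subset_chain_def)
    then show "\<Union>C \<in> F" using C by (auto simp: F_def subset_chain_def)
  qed
  then obtain M where M: "M \<in> F" and max: "\<And>X. \<lbrakk>X \<in> F; M \<subseteq> X\<rbrakk> \<Longrightarrow> X = M" by blast
  have "L = M \<or> L = carrier R" if L: "left_ideal L R" "M \<subseteq> L" for L
  proof (cases "\<one> \<in> L")
    case True
    then show ?thesis using left_ideal_eq_carrier[OF L(1)] by blast
  next
    case False
    then show ?thesis using max L M by (auto simp: F_def)
  qed
  then have "maximal_left_ideal M R"
    using M by (auto simp: maximal_left_ideal_def F_def)
  with M that show ?thesis by (auto simp: F_def)
qed

lemma left_ideal_jacobson: "left_ideal (jacobson_radical R) R"
proof (rule left_idealI)
  have "left_ideal M R" if "maximal_left_ideal M R" for M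
    using that by (simp add: maximal_left_ideal_def)
  note MD = left_idealD[OF this]
  show "jacobson_radical R \<subseteq> carrier R" "\<zero> \<in> jacobson_radical R"
    "\<And>x y. \<lbrakk>x \<in> jacobson_radical R; y \<in> jacobson_radical R\<rbrakk> \<Longrightarrow> x \<oplus> y \<in> jacobson_radical R"
    "\<And>r x. \<lbrakk>r \<in> carrier R; x \<in> jacobson_radical R\<rbrakk> \<Longrightarrow> r \<otimes> x \<in> jacobson_radical R"
    using MD by (auto simp: jacobson_radical_def)
qed

lemmas jacobsonD = left_idealD[OF left_ideal_jacobson]

text \<open>If the left ideal generated by \<open>\<one> \<oplus> z\<close> were proper, a maximal
  left ideal would contain it together with \<open>z\<close>, and hence
  \<open>\<one>\<close>.\<close>

lemma one_plus_jacobson_left_inverse: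
  assumes z: "z \<in> jacobson_radical R"
  obtains u where "u \<in> carrier R" "u \<otimes> (\<one> \<oplus> z) = \<one>"
proof -
  have zc: "z \<in> carrier R" using z jacobsonD(1) by blast
  define I where "I = {m \<oplus> r \<otimes> (\<one> \<oplus> z) | m r. m \<in> {\<zero>} \<and> r \<in> carrier R}"
  have "left_ideal {\<zero>} R" by (intro left_idealI) auto
  then have I: "left_ideal I R" unfolding I_def by (rule left_ideal_add_principal) (simp add: zc)
  have "\<zero> \<oplus> \<one> \<otimes> (\<one> \<oplus> z) \<in> I" unfolding I_def by blast
  then have zI: "\<one> \<oplus> z \<in> I" using zc by simp
  have "\<one> \<in> I"
  proof (rule ccontr)
    assume "\<one> \<notin> I"
    then obtain M where M: "maximal_left_ideal M R" "I \<subseteq> M"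
      using exists_maximal_left_ideal[OF I] by blast
    then have MD: "left_ideal M R" "M \<noteq> carrier R" by (simp_all add: maximal_left_ideal_def)
    have "z \<in> M" using z M by (simp add: jacobson_radical_def)
    then have "(\<one> \<oplus> z) \<oplus> \<ominus> z \<in> M" using left_idealD(3,5)[OF MD(1)] M zI by blast
    then have "\<one> \<in> M" using zc by (simp add: a_assoc r_neg)
    then show False using left_ideal_eq_carrier[OF MD(1)] MD(2) by blast
  qed
  then obtain r where "r \<in> carrier R" "\<one> = \<zero> \<oplus> r \<otimes> (\<one> \<oplus> z)" unfolding I_def by blast
  then show ?thesis using that[of r] zc by simp
qed

text \<open>A left inverse \<open>u\<close> equals \<open>\<one>\<close> minus
  \<open>u \<otimes> z\<close>, so it again has the form \<open>\<one>\<close> plus a radical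
  element and has a left inverse \<open>v\<close>. Then \<open>v = \<one> \<oplus> z\<close>, so
  \<open>u\<close> is a two-sided inverse.\<close>

lemma one_plus_jacobson_Units:
  assumes z: "z \<in> jacobson_radical R"
  shows "\<one> \<oplus> z \<in> Units R"
proof -
  have zc: "z \<in> carrier R" using z jacobsonD(1) by blast
  obtain u where u: "u \<in> carrier R" "u \<otimes> (\<one> \<oplus> z) = \<one>"
    using one_plus_jacobson_left_inverse[OF z] .
  have "u \<oplus> u \<otimes> z = \<one>" using u zc by (simp add: r_distr)
  then have "u = \<one> \<oplus> \<ominus> (u \<otimes> z)"
    using u zc by (metis a_minus_def add.inv_solve_right m_closed one_closed)
  moreover have "\<ominus> (u \<otimes> z) \<in> jacobson_radical R" using jacobsonD(4,5) u z by blast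
  ultimately obtain v where v: "v \<in> carrier R" "v \<otimes> u = \<one>"
    using one_plus_jacobson_left_inverse by metis
  have "v = v \<otimes> (u \<otimes> (\<one> \<oplus> z))" using u v by simp
  also have "\<dots> = \<one> \<oplus> z"
    using m_assoc[OF v(1) u(1), of "\<one> \<oplus> z"] v(2) zc by simp
  finally show ?thesis using u v zc UnitsI_inverses[of "\<one> \<oplus> z" u u] by simp
qed

text \<open>Here \<open>s\<close> is the finite geometric series in \<open>\<ominus> z\<close>, a
  cofactor on both sides. Only membership of \<open>y\<close> in the radical matters later, so its
  sign is left open.\<close>

lemma one_plus_dvd_one_plus_power:
  assumes z: "z \<in> carrier R"
  shows "\<exists>s y. s \<in> carrier R \<and> y \<in> {z [^] (n::nat), \<ominus> (z [^] n)} \<and>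
    s \<otimes> (\<one> \<oplus> z) = \<one> \<oplus> y \<and> (\<one> \<oplus> z) \<otimes> s = \<one> \<oplus> y"
proof (induction n)
  case 0
  have "\<zero> \<otimes> (\<one> \<oplus> z) = \<one> \<oplus> \<ominus> \<one> \<and> (\<one> \<oplus> z) \<otimes> \<zero> = \<one> \<oplus> \<ominus> \<one>"
    using z by (simp add: r_neg)
  then show ?case using nat_pow_0[of z] zero_closed by (metis insertCI)
next
  case (Suc n)
  then obtain s y where s: "s \<in> carrier R" "y \<in> {z [^] n, \<ominus> (z [^] n)}"
    "s \<otimes> (\<one> \<oplus> z) = \<one> \<oplus> y" "(\<one> \<oplus> z) \<otimes> s = \<one> \<oplus> y" by blast
  have y: "y \<in> carrier R" using s z by auto
  have comm: "z \<otimes> y = y \<otimes> z"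
    using s(2) z nat_pow_Suc2[of z n] nat_pow_Suc[of z n] by (auto simp: l_minus r_minus)
  have cancel: "(a \<oplus> b) \<oplus> (\<ominus> b \<oplus> c) = a \<oplus> c"
    if "a \<in> carrier R" "b \<in> carrier R" "c \<in> carrier R" for a b c
    using that by (simp add: a_assoc r_neg1 r_neg2)
  \<comment> \<open>The next cofactor is \<open>s \<oplus> \<ominus> y\<close>: the term
    \<open>y\<close> cancels and the remainder becomes
    \<open>\<ominus> (y \<otimes> z)\<close>.\<close>
  have "(s \<oplus> \<ominus> y) \<otimes> (\<one> \<oplus> z) = \<one> \<oplus> \<ominus> (y \<otimes> z)"
    using s y z cancel[of \<one> y "\<ominus> (y \<otimes> z)"]
    by (simp add: l_distr[of s "\<ominus> y"]) (simp add: r_distr l_minus)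
  moreover have "(\<one> \<oplus> z) \<otimes> (s \<oplus> \<ominus> y) = \<one> \<oplus> \<ominus> (y \<otimes> z)"
  proof -
    have "(\<one> \<oplus> z) \<otimes> (s \<oplus> \<ominus> y) = (\<one> \<oplus> y) \<oplus> \<ominus> ((\<one> \<oplus> z) \<otimes> y)"
      using s(1,4) y z r_distr[of s "\<ominus> y" "\<one> \<oplus> z"] r_minus[of "\<one> \<oplus> z" y] by simp
    also have "\<ominus> ((\<one> \<oplus> z) \<otimes> y) = \<ominus> y \<oplus> \<ominus> (y \<otimes> z)"
      using y z by (simp add: l_distr comm minus_add)
    finally show ?thesis using y z cancel[of \<one> y "\<ominus> (y \<otimes> z)"] by simp
  qed
  moreover have "\<ominus> (y \<otimes> z) \<in> {z [^] Suc n, \<ominus> (z [^] Suc n)}"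
    using s(2) z by (auto simp: l_minus)
  ultimately show ?case using s(1) y by (metis a_closed a_inv_closed)
qed

lemma one_plus_J_sharp_Units:
  assumes "z \<in> J_sharp R"
  shows "\<one> \<oplus> z \<in> Units R"
proof -
  from assms obtain n :: nat where z: "z \<in> carrier R" "z [^] n \<in> jacobson_radical R"
    by (auto simp: J_sharp_def)
  obtain s y where s: "s \<in> carrier R" "y \<in> {z [^] n, \<ominus> (z [^] n)}"
    "s \<otimes> (\<one> \<oplus> z) = \<one> \<oplus> y" "(\<one> \<oplus> z) \<otimes> s = \<one> \<oplus> y"
    using one_plus_dvd_one_plus_power[OF z(1)] by blast
  have "y \<in> jacobson_radical R" using s(2) z(2) jacobsonD(5) by auto
  then have u: "\<one> \<oplus> y \<in> Units R" by (rule one_plus_jacobson_Units)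
  show ?thesis
  proof (rule UnitsI_inverses)
    show "(inv (\<one> \<oplus> y) \<otimes> s) \<otimes> (\<one> \<oplus> z) = \<one>" using u s z by (simp add: m_assoc)
    show "(\<one> \<oplus> z) \<otimes> (s \<otimes> inv (\<one> \<oplus> y)) = \<one>" using u s z by (simp flip: m_assoc)
  qed (use u s z in auto)
qed

lemma jacobson_subset_J_sharp: "jacobson_radical R \<subseteq> J_sharp R"
proof
  fix z assume z: "z \<in> jacobson_radical R"
  then have "z [^] (1::nat) \<in> jacobson_radical R" using jacobsonD(1) by simp
  then show "z \<in> J_sharp R" using z jacobsonD(1) unfolding J_sharp_def by blast
qed

lemma nilpotents_subset_J_sharp: "nilpotents R \<subseteq> J_sharp R"
  using jacobsonD(2) by (auto simp: nilpotents_def J_sharp_def)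

text \<open>If a maximal \<open>M\<close> misses \<open>x\<close>, then
  \<open>\<one> = m \<oplus> r \<otimes> x\<close> with \<open>m\<close> in \<open>M\<close>. As
  \<open>r \<otimes> x\<close> lies in \<open>I\<close> it is nilpotent, so \<open>m\<close> is a
  unit, which is absurd.\<close>

lemma nil_left_ideal_subset_jacobson:
  assumes I: "left_ideal I R" "I \<subseteq> nilpotents R"
  shows "I \<subseteq> jacobson_radical R"
proof
  fix x assume x: "x \<in> I"
  then have xc: "x \<in> carrier R" using left_idealD(1)[OF I(1)] by blast
  have "x \<in> M" if M: "maximal_left_ideal M R" for M
  proof (rule ccontr)
    assume xM: "x \<notin> M"
    have MD: "left_ideal M R" "M \<noteq> carrier R"
      and max: "\<And>L. \<lbrakk>left_ideal L R; M \<subseteq> L\<rbrakk> \<Longrightarrow> L = M \<or> L = carrier R"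
      using M by (auto simp: maximal_left_ideal_def)
    define L where "L = {m \<oplus> r \<otimes> x | m r. m \<in> M \<and> r \<in> carrier R}"
    have L: "left_ideal L R" unfolding L_def by (rule left_ideal_add_principal[OF MD(1) xc])
    have "m \<in> L" if "m \<in> M" for m
    proof -
      have "m = m \<oplus> \<zero> \<otimes> x" using left_idealD(1)[OF MD(1) that] xc by simp
      then show ?thesis using that unfolding L_def by blast
    qed
    moreover have "x \<in> L"
    proof -
      have "x = \<zero> \<oplus> \<one> \<otimes> x" using xc by simp
      then show ?thesis using left_idealD(2)[OF MD(1)] unfolding L_def by blast
    qed
    ultimately have "L = carrier R" using max[OF L] xM by blast
    then obtain m r where m: "\<one> = m \<oplus> r \<otimes> x" "m \<in> M" "r \<in> carrier R"
      unfolding L_def using one_closed by blast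
    have "m = \<one> \<oplus> \<ominus> (r \<otimes> x)"
      using m left_idealD(1)[OF MD(1)] xc by (simp add: a_assoc r_neg)
    moreover have "\<ominus> (r \<otimes> x) \<in> nilpotents R"
      using left_idealD(4,5)[OF I(1)] x m I(2) by blast
    ultimately have "m \<in> Units R" using one_plus_J_sharp_Units nilpotents_subset_J_sharp by blast
    then show False using left_ideal_eq_carrier[OF MD(1)] m MD(2) by blast
  qed
  then show "x \<in> jacobson_radical R" using xc by (simp add: jacobson_radical_def)
qed

end

section \<open>The prime radical\<close>

text \<open>The \<open>k\<close>-th power of the set \<open>F\<close> under elementwise products.
  That it is contained in \<open>{\<zero>}\<close> says that all products of \<open>k\<close>
  elements of \<open>F\<close> vanish.\<close>

primrec words :: "('a, 'b) ring_scheme \<Rightarrow> 'a set \<Rightarrow> nat \<Rightarrow> 'a set" where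
  "words R F 0 = {\<one>\<^bsub>R\<^esub>}"
| "words R F (Suc k) = F <#>\<^bsub>R\<^esub> words R F k"

context ring
begin

lemma words_closed:
  assumes "F \<subseteq> carrier R"
  shows "words R F k \<subseteq> carrier R"
  using assms by (induction k) (auto simp: set_mult_def)

lemma finite_words: "finite F \<Longrightarrow> finite (words R F k)"
  by (induction k) (auto simp: set_mult_def)

lemma words_add:
  assumes "F \<subseteq> carrier R" "w \<in> words R F (k + l)"
  shows "\<exists>u\<in>words R F k. \<exists>v\<in>words R F l. w = u \<otimes> v"
  using assms(2)
proof (induction k arbitrary: w)
  case 0
  moreover have "w \<in> carrier R" using words_closed[OF assms(1)] 0 by auto
  ultimately show ?case using 0 by (intro bexI[of _ \<one>] bexI[of _ w]) auto
next
  case (Suc k)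
  then obtain a w' where w: "w = a \<otimes> w'" "a \<in> F" "w' \<in> words R F (k + l)"
    by (auto simp: set_mult_def)
  then obtain u v where uv: "u \<in> words R F k" "v \<in> words R F l" "w' = u \<otimes> v"
    using Suc.IH by blast
  have "w = (a \<otimes> u) \<otimes> v"
    using w uv assms(1) words_closed[OF assms(1)] by (simp add: m_assoc subset_iff)
  then show ?case using w uv by (auto simp: set_mult_def)
qed

text \<open>An ideal \<open>P\<close> maximal among those containing no \<open>words R F k\<close>
  is prime: if \<open>P\<close> + \<open>I\<close> contains the words of length \<open>k\<close> and
  \<open>P\<close> + \<open>J\<close> those of length \<open>l\<close>, then \<open>P\<close> +
  \<open>I \<cdot> J\<close> contains those of length \<open>k + l\<close>.\<close>

lemma words_prime_avoiding:
  assumes F: "finite F" "F \<subseteq> carrier R" and nz: "\<And>k. \<not> words R F k \<subseteq> {\<zero>}"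
  obtains P where "nc_prime_ideal P R" "\<not> F \<subseteq> P"
proof -
  define A where "A = {P. ideal P R \<and> (\<forall>k. \<not> words R F k \<subseteq> P)}"
  have "\<exists>P\<in>A. \<forall>X\<in>A. P \<subseteq> X \<longrightarrow> X = P"
  proof (rule subset_Zorn_nonempty)
    show "A \<noteq> {}" using nz zeroideal by (auto simp: A_def)
    fix C assume C: "C \<noteq> {}" "subset.chain A C"
    have "subset.chain {I. ideal I R} C" using C(2) by (auto simp: A_def subset_chain_def)
    then have "ideal (\<Union>C) R" using chain_Union_is_ideal[of C] C(1) by simp
    moreover have "\<not> words R F k \<subseteq> \<Union>C" for k
    proof
      \<comment> \<open>Finiteness of \<open>F\<close> enters here: a finite set covered by a chain
        lies in one of its members.\<close>
      assume "words R F k \<subseteq> \<Union>C"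
      then obtain I where "I \<in> C" "words R F k \<subseteq> I"
        using finite_subset_Union_chain[OF finite_words[OF F(1)] _ C] by metis
      then show False using C(2) by (auto simp: A_def subset_chain_def)
    qed
    ultimately show "\<Union>C \<in> A" by (simp add: A_def)
  qed
  then obtain P where P: "P \<in> A" and max: "\<And>X. \<lbrakk>X \<in> A; P \<subseteq> X\<rbrakk> \<Longrightarrow> X = P" by blast
  have idl: "ideal P R" and nsub: "\<And>k. \<not> words R F k \<subseteq> P" using P by (auto simp: A_def)
  interpret P: ideal P R by (rule idl)
  have grow: "\<exists>k. words R F k \<subseteq> P <+>\<^bsub>R\<^esub> I" if I: "ideal I R" "\<not> I \<subseteq> P" for I
  proof (rule ccontr)
    assume no: "\<nexists>k. words R F k \<subseteq> P <+>\<^bsub>R\<^esub> I"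
    interpret I: ideal I R by (rule I(1))
    have "P <+>\<^bsub>R\<^esub> I \<in> A" using no add_ideals[OF idl I(1)] by (auto simp: A_def)
    moreover have "p \<in> P <+>\<^bsub>R\<^esub> I" if "p \<in> P" for p
    proof -
      have "p \<oplus> \<zero> \<in> P <+>\<^bsub>R\<^esub> I"
        unfolding set_add_def' using that I.zero_closed by blast
      then show ?thesis using P.Icarr[OF that] by simp
    qed
    moreover have "i \<in> P <+>\<^bsub>R\<^esub> I" if "i \<in> I" for i
    proof -
      have "\<zero> \<oplus> i \<in> P <+>\<^bsub>R\<^esub> I"
        unfolding set_add_def' using that P.zero_closed by blast
      then show ?thesis using I.Icarr[OF that] by simp
    qed
    ultimately have "P <+>\<^bsub>R\<^esub> I = P" "I \<subseteq> P <+>\<^bsub>R\<^esub> I" using max by (auto simp: subset_iff)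
    then show False using I(2) by blast
  qed
  have "I \<subseteq> P \<or> J \<subseteq> P" if I: "ideal I R" and J: "ideal J R" and IJ: "I \<cdot> J \<subseteq> P" for I J
  proof (rule ccontr)
    assume "\<not> (I \<subseteq> P \<or> J \<subseteq> P)"
    then obtain k l where kl: "words R F k \<subseteq> P <+>\<^bsub>R\<^esub> I" "words R F l \<subseteq> P <+>\<^bsub>R\<^esub> J"
      using grow I J by meson
    interpret I: ideal I R by (rule I)
    interpret J: ideal J R by (rule J)
    have "w \<in> P" if w: "w \<in> words R F (k + l)" for w
    proof -
      obtain u v where uv: "u \<in> P <+>\<^bsub>R\<^esub> I" "v \<in> P <+>\<^bsub>R\<^esub> J" "w = u \<otimes> v"
        using words_add[OF F(2) w] kl by blast
      then obtain p i q j where e: "u = p \<oplus> i" "p \<in> P" "i \<in> I" "v = q \<oplus> j" "q \<in> P" "j \<in> J"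
        by (auto simp: set_add_def')
      have c: "p \<in> carrier R" "i \<in> carrier R" "q \<in> carrier R" "j \<in> carrier R"
        using e P.Icarr I.Icarr J.Icarr by auto
      \<comment> \<open>Every product in the expansion other than \<open>i \<otimes> j\<close> has a
        factor in \<open>P\<close>.\<close>
      have "w = p \<otimes> v \<oplus> (i \<otimes> q \<oplus> i \<otimes> j)"
        unfolding uv(3) e(1) e(4) using c l_distr[of p i "q \<oplus> j"] r_distr[of q j i]
        by (simp only: a_closed)
      moreover have "i \<otimes> j \<in> P" using IJ ideal_prod.prod[OF e(3) e(6), of R] by (rule subsetD)
      moreover have "p \<otimes> v \<in> P" using P.I_r_closed e c by simp
      moreover have "i \<otimes> q \<in> P" using P.I_l_closed e c by simp
      ultimately show ?thesis by (simp only: P.a_closed)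
    qed
    then have "words R F (k + l) \<subseteq> P" by (rule subsetI)
    then show False using nsub by (rule notE[rotated])
  qed
  moreover have "P \<noteq> carrier R" using nsub words_closed[OF F(2)] by blast
  ultimately have "nc_prime_ideal P R" using idl by (simp add: nc_prime_ideal_def)
  moreover have "\<not> F \<subseteq> P"
  proof
    assume "F \<subseteq> P"
    then have "words R F 1 \<subseteq> P" using F(2) by (auto simp: set_mult_def)
    then show False using nsub by (rule notE[rotated])
  qed
  ultimately show ?thesis by (rule that)
qed

text \<open>Otherwise some prime ideal would fail to contain \<open>F\<close>, although the prime
  radical lies in all of them.\<close>

lemma prime_radical_locally_nilpotent:
  assumes "finite F" "F \<subseteq> prime_radical R"
  obtains k where "words R F k \<subseteq> {\<zero>}"
proof -
  have F: "F \<subseteq> carrier R" using assms(2) by (auto simp: prime_radical_def)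
  have "\<exists>k. words R F k \<subseteq> {\<zero>}"
  proof (rule ccontr)
    assume "\<not> ?thesis"
    then obtain P where "nc_prime_ideal P R" "\<not> F \<subseteq> P"
      using words_prime_avoiding[OF assms(1) F] by blast
    then show False using assms(2) by (auto simp: prime_radical_def)
  qed
  then show ?thesis using that by blast
qed

lemma ideal_prime_radical: "ideal (prime_radical R) R"
proof -
  \<comment> \<open>Inserting \<open>carrier R\<close> keeps the family nonempty when there are no
    prime ideals.\<close>
  have "prime_radical R = \<Inter>(insert (carrier R) {P. nc_prime_ideal P R})"
    by (auto simp: prime_radical_def)
  then show ?thesis
    by (simp only:) (rule i_Intersect, auto simp: nc_prime_ideal_def oneideal)
qed

end

section \<open>Finite sums and nilpotent elements\<close>

lemma (in additive_subgroup) finsum_mem: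
  assumes "abelian_group G" "\<And>i. i \<in> A \<Longrightarrow> t i \<in> H"
  shows "finsum G t A \<in> H"
proof -
  interpret abelian_group G by (rule assms(1))
  show ?thesis
    using assms(2)
  proof (induction A rule: infinite_finite_induct)
    case (insert a A)
    then have "t \<in> A \<rightarrow> carrier G" "t a \<in> carrier G" using a_Hcarr by auto
    then show ?case using insert by simp
  qed auto
qed

text \<open>Solve the vanishing sum for \<open>t a\<close>. This isolates one term of a polynomial
  coefficient modulo the nilpotents.\<close>

lemma (in ring) finsum_zero_remaining_mem:
  assumes "additive_subgroup H R" "finite A" "a \<in> A" "t \<in> A \<rightarrow> carrier R"
    and "finsum R t A = \<zero>" "\<And>i. \<lbrakk>i \<in> A; i \<noteq> a\<rbrakk> \<Longrightarrow> t i \<in> H"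
  shows "t a \<in> H"
proof -
  interpret H: additive_subgroup H R by (rule assms(1))
  let ?s = "finsum R t (A - {a})"
  have s: "?s \<in> H" using assms(6) by (intro H.finsum_mem abelian_group_axioms) auto
  have "finsum R t (insert a (A - {a})) = t a \<oplus> ?s"
    using assms(2-4) by (intro finsum_insert) auto
  then have "t a \<oplus> ?s = \<zero>" using assms(3,5) by (simp add: insert_absorb)
  then have "t a = \<ominus> ?s" using assms(3,4) s H.a_Hcarr by (metis Pi_mem minus_equality)
  then show ?thesis using s H.a_inv_closed by simp
qed

context ring
begin

lemma nilpotents_power_iff:
  assumes "x \<in> carrier R" "n \<ge> 1"
  shows "x [^] (n::nat) \<in> nilpotents R \<longleftrightarrow> x \<in> nilpotents R"
proof
  assume "x [^] n \<in> nilpotents R"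
  then obtain m :: nat where "m \<ge> 1" "x [^] (n * m) = \<zero>"
    using assms(1) by (auto simp: nilpotents_def nat_pow_pow)
  moreover from this assms(2) have "n * m \<ge> 1" by simp
  ultimately show "x \<in> nilpotents R" using assms(1) unfolding nilpotents_def by blast
next
  assume "x \<in> nilpotents R"
  then obtain m :: nat where m: "m \<ge> 1" "x [^] m = \<zero>" by (auto simp: nilpotents_def)
  have "(x [^] n) [^] m = (x [^] m) [^] n" using assms(1) by (simp add: nat_pow_pow mult.commute)
  also have "\<dots> = \<zero>" using m assms(2) by (simp add: nat_pow_zero)
  finally show "x [^] n \<in> nilpotents R" using m(1) assms(1) unfolding nilpotents_def by blast
qed

text \<open>A power of \<open>b \<otimes> a\<close> is \<open>b\<close> times the preceding power of
  \<open>a \<otimes> b\<close> times \<open>a\<close>.\<close>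

lemma nilpotents_mult_commute:
  assumes ab: "a \<in> carrier R" "b \<in> carrier R" and nil: "a \<otimes> b \<in> nilpotents R"
  shows "b \<otimes> a \<in> nilpotents R"
proof -
  have pow: "(b \<otimes> a) [^] Suc k = b \<otimes> (a \<otimes> b) [^] k \<otimes> a" for k
    using ab by (induction k) (simp_all add: m_assoc)
  obtain k :: nat where "(a \<otimes> b) [^] k = \<zero>" using nil by (auto simp: nilpotents_def)
  then have "(b \<otimes> a) [^] Suc k = \<zero>" using pow[of k] ab by simp
  moreover have "Suc k \<ge> 1" by simp
  ultimately show ?thesis using ab unfolding nilpotents_def by blast
qed

end

section \<open>Compatible endomorphisms of 2-primal rings\<close>

locale compatible_two_primal_ring = ring R for R (structure) +
  fixes \<alpha> :: "'a \<Rightarrow> 'a"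
  assumes two_primal: "two_primal R"
    and hom: "\<alpha> \<in> ring_hom R R"
    and compatible: "compatible R \<alpha>"
begin

abbreviation "N \<equiv> nilpotents R"
abbreviation "S \<equiv> skew_UP R \<alpha>"

lemma funpow_closed [simp]: "a \<in> carrier R \<Longrightarrow> (\<alpha> ^^ i) a \<in> carrier R"
  using ring_hom_closed[OF funpow_ring_hom[OF hom]] .

sublocale N: ideal N R
  using ideal_prime_radical two_primal by (simp add: two_primal_def)

text \<open>Apply compatibility to the product \<open>b \<otimes> c\<close>, split its image, and
  then remove \<alpha> from \<open>c\<close> by compatibility with left factor
  \<open>a \<otimes> \<alpha> b\<close>.\<close>

lemma mult_endo_mult_eq_zero_iff:
  assumes "a \<in> carrier R" "b \<in> carrier R" "c \<in> carrier R"
  shows "a \<otimes> \<alpha> b \<otimes> c = \<zero> \<longleftrightarrow> a \<otimes> b \<otimes> c = \<zero>"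
proof -
  note cl = ring_hom_closed[OF hom]
  have "a \<otimes> b \<otimes> c = \<zero> \<longleftrightarrow> a \<otimes> (b \<otimes> c) = \<zero>" using assms by (simp add: m_assoc)
  also have "\<dots> \<longleftrightarrow> a \<otimes> \<alpha> (b \<otimes> c) = \<zero>"
    using compatible assms unfolding compatible_def by blast
  also have "\<dots> \<longleftrightarrow> a \<otimes> \<alpha> b \<otimes> \<alpha> c = \<zero>"
    using assms cl by (simp add: ring_hom_mult[OF hom] m_assoc)
  also have "\<dots> \<longleftrightarrow> a \<otimes> \<alpha> b \<otimes> c = \<zero>"
    using compatible assms cl[of b] unfolding compatible_def by blast
  finally show ?thesis by blast
qed

lemma mult_funpow_mult_eq_zero_iff:
  assumes "a \<in> carrier R" "b \<in> carrier R" "c \<in> carrier R"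
  shows "a \<otimes> (\<alpha> ^^ i) b \<otimes> c = \<zero> \<longleftrightarrow> a \<otimes> b \<otimes> c = \<zero>"
  using assms by (induction i) (simp_all add: mult_endo_mult_eq_zero_iff)

text \<open>Compatibility modulo \<open>N\<close>: in a power of the product, \<alpha> can be
  stripped from one factor at a time without affecting whether it vanishes.\<close>

lemma mult_funpow_nilpotent_iff:
  assumes ab: "a \<in> carrier R" "b \<in> carrier R"
  shows "a \<otimes> (\<alpha> ^^ i) b \<in> N \<longleftrightarrow> a \<otimes> b \<in> N"
proof -
  let ?b = "(\<alpha> ^^ i) b"
  \<comment> \<open>The arbitrary left factor \<open>c\<close> lets the induction hypothesis apply
    with the prefix \<open>c \<otimes> a \<otimes> ?b\<close>.\<close>
  have "c \<otimes> (a \<otimes> ?b) [^] k = \<zero> \<longleftrightarrow> c \<otimes> (a \<otimes> b) [^] k = \<zero>" if "c \<in> carrier R" for c and k :: nat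
    using that
  proof (induction k arbitrary: c)
    case (Suc k)
    have "c \<otimes> (a \<otimes> ?b) [^] Suc k = (c \<otimes> a \<otimes> ?b) \<otimes> (a \<otimes> ?b) [^] k"
      using Suc.prems ab by (simp only: nat_pow_Suc2 m_closed funpow_closed) (simp add: m_assoc)
    also have "\<dots> = \<zero> \<longleftrightarrow> (c \<otimes> a) \<otimes> ?b \<otimes> (a \<otimes> b) [^] k = \<zero>"
      using Suc ab by simp
    also have "\<dots> \<longleftrightarrow> (c \<otimes> a) \<otimes> b \<otimes> (a \<otimes> b) [^] k = \<zero>"
      using Suc.prems ab by (intro mult_funpow_mult_eq_zero_iff) auto
    also have "(c \<otimes> a) \<otimes> b \<otimes> (a \<otimes> b) [^] k = c \<otimes> (a \<otimes> b) [^] Suc k"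
      using Suc.prems ab by (simp only: nat_pow_Suc2 m_closed) (simp add: m_assoc)
    finally show ?case .
  qed simp
  from this[of \<one>] have "(a \<otimes> ?b) [^] k = \<zero> \<longleftrightarrow> (a \<otimes> b) [^] k = \<zero>" for k :: nat
    using ab by simp
  then show ?thesis using ab by (simp only: nilpotents_def mem_Collect_eq m_closed funpow_closed)
qed

text \<open>This reflects that \<open>R\<close> modulo \<open>N\<close> is reduced: commuting the
  factors puts \<open>a \<otimes> b \<otimes> a\<close> in \<open>N\<close>, hence also the square
  of \<open>a \<otimes> b\<close>.\<close>

lemma mult_nilpotent_if_square_mult:
  assumes ab: "a \<in> carrier R" "b \<in> carrier R" and "a \<otimes> (a \<otimes> b) \<in> N"
  shows "a \<otimes> b \<in> N"
proof -
  have "a \<otimes> b \<otimes> a \<in> N" using nilpotents_mult_commute[OF _ _ assms(3)] ab by simp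
  then have "a \<otimes> b \<otimes> a \<otimes> b \<in> N" using N.I_r_closed ab by blast
  then have "(a \<otimes> b) [^] (2::nat) \<in> N" using ab by (simp add: numeral_2_eq_2 m_assoc)
  then show ?thesis using nilpotents_power_iff[of "a \<otimes> b" 2] ab by simp
qed

section \<open>Skew polynomials over such rings\<close>

sublocale S: ring S by (rule skew_UP_is_ring[OF hom])

lemma S_mult_0: "\<lbrakk>p \<in> up R; q \<in> up R\<rbrakk> \<Longrightarrow> (p \<otimes>\<^bsub>S\<^esub> q) 0 = p 0 \<otimes> q 0"
  by (simp add: skew_UP_simps mem_upD)

section \<open>The nil left ideal of polynomials with nilpotent coefficients\<close>

definition nil_polys :: "(nat \<Rightarrow> 'a) set" where
  "nil_polys = {p \<in> up R. \<forall>i. p i \<in> N}"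

lemma left_ideal_nil_polys: "left_ideal nil_polys S"
proof (rule S.left_idealI)
  show "nil_polys \<subseteq> carrier S" by (auto simp: nil_polys_def skew_UP_simps)
  show "\<zero>\<^bsub>S\<^esub> \<in> nil_polys"
    using S.zero_closed N.zero_closed by (simp add: nil_polys_def skew_UP_simps)
  show "p \<oplus>\<^bsub>S\<^esub> q \<in> nil_polys" if "p \<in> nil_polys" "q \<in> nil_polys" for p q
    using that S.a_closed[of p q] N.a_closed by (simp add: nil_polys_def skew_UP_simps)
  show "p \<otimes>\<^bsub>S\<^esub> q \<in> nil_polys" if p: "p \<in> carrier S" and q: "q \<in> nil_polys" for p q
  proof -
    have up: "p \<in> up R" "q \<in> up R" "p \<otimes>\<^bsub>S\<^esub> q \<in> up R"
      using p q S.m_closed[of p q] by (simp_all add: nil_polys_def skew_UP_simps(1))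
    \<comment> \<open>Since \<open>q j\<close> is in the ideal \<open>N\<close>, so is
      \<open>p i \<otimes> q j\<close>; compatibility modulo \<open>N\<close> inserts the power of
      \<alpha>.\<close>
    have "p i \<otimes> (\<alpha> ^^ i) (q j) \<in> N" for i j
      using mult_funpow_nilpotent_iff[of "p i" "q j"] N.I_l_closed up(1,2) q
      by (simp add: nil_polys_def mem_upD)
    then have "(\<Oplus>i\<in>{..n}. p i \<otimes> (\<alpha> ^^ i) (q (n - i))) \<in> N" for n
      by (intro N.finsum_mem abelian_group_axioms)
    then show ?thesis using up by (simp add: nil_polys_def skew_UP_simps(5))
  qed
qed

text \<open>Multiplying by \<open>q\<close> shortens by one the words that the coefficients
  annihilate: prefixing \<open>q j\<close> to \<open>w\<close> gives a longer word, and the powers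
  of \<alpha> do not affect vanishing.\<close>

lemma mult_kills_words:
  assumes p: "p \<in> up R" and q: "q \<in> up R"
    and kill: "\<And>i w. w \<in> words R (range q) (Suc k) \<Longrightarrow> p i \<otimes> w = \<zero>"
    and w: "w \<in> words R (range q) k"
  shows "(p \<otimes>\<^bsub>S\<^esub> q) n \<otimes> w = \<zero>"
proof -
  have wc: "w \<in> carrier R" using words_closed[of "range q" k] w q by (auto simp: mem_upD)
  have "p i \<otimes> (\<alpha> ^^ i) (q j) \<otimes> w = \<zero>" for i j
  proof -
    have "q j \<otimes> w \<in> words R (range q) (Suc k)" using w by (auto simp: set_mult_def)
    then have "p i \<otimes> q j \<otimes> w = \<zero>" using kill p q wc by (simp add: m_assoc mem_upD)
    then show ?thesis using mult_funpow_mult_eq_zero_iff p q wc by (simp add: mem_upD)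
  qed
  then show ?thesis
    using p q wc by (simp add: skew_UP_simps finsum_ldistr mem_upD Pi_def)
qed

lemma nil_polys_nilpotent: "nil_polys \<subseteq> nilpotents S"
proof
  fix q assume q: "q \<in> nil_polys"
  then have up: "q \<in> up R" and qN: "range q \<subseteq> N" by (auto simp: nil_polys_def)
  obtain m where m: "bound \<zero> m q" using up by (auto simp: up_def)
  \<comment> \<open>A polynomial has only finitely many distinct coefficients, so local nilpotence
    applies to them.\<close>
  have "range q \<subseteq> insert \<zero> (q ` {..m})"
    using bound.bound[OF m] by (force simp: not_le[symmetric])
  then have "finite (range q)" by (rule finite_subset) simp
  then obtain k where k: "words R (range q) k \<subseteq> {\<zero>}"
    using prime_radical_locally_nilpotent[of "range q"] qN two_primal
    by (auto simp: two_primal_def)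
  have pow: "q [^]\<^bsub>S\<^esub> j \<in> up R" for j :: nat
    using S.nat_pow_closed[of q j] up by (simp add: skew_UP_simps)
  \<comment> \<open>The word length falls as the exponent rises. At \<open>j = k\<close> only the
    empty word \<open>\<one>\<close> is left, so all coefficients vanish.\<close>
  have "(q [^]\<^bsub>S\<^esub> j) i \<otimes> w = \<zero>" if "j \<le> k" "w \<in> words R (range q) (k - j)" for j i w
    using that
  proof (induction j arbitrary: i w)
    case 0
    then have "w = \<zero>" using k by auto
    then show ?case using pow[of 0] by (simp add: mem_upD)
  next
    case (Suc j)
    then have "k - j = Suc (k - Suc j)" by simp
    then show ?case
      using mult_kills_words[OF pow up, of "k - Suc j" j w i] Suc by simp
  qed
  from this[of k \<one>] have "(q [^]\<^bsub>S\<^esub> k) i = \<zero>" for i using pow[of k] by (simp add: mem_upD)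
  then have "q [^]\<^bsub>S\<^esub> k = \<zero>\<^bsub>S\<^esub>" by (auto simp: skew_UP_simps)
  then have "q [^]\<^bsub>S\<^esub> Suc k = \<zero>\<^bsub>S\<^esub>" using up by (simp add: skew_UP_simps(1))
  moreover have "Suc k \<ge> 1" by simp
  ultimately show "q \<in> nilpotents S"
    using up skew_UP_simps(1)[of R \<alpha>] unfolding nilpotents_def by blast
qed

lemma nil_polys_subset_jacobson: "nil_polys \<subseteq> jacobson_radical S"
  by (rule S.nil_left_ideal_subset_jacobson[OF left_ideal_nil_polys nil_polys_nilpotent])

text \<open>Multiply the \<open>n + j\<close>-th coefficient of \<open>p q\<close> by \<open>p n\<close> on the left and descend on \<open>j\<close>,
  working modulo the nilpotents.\<close>

lemma leading_coeff_annihilates: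
  assumes p: "p \<in> up R" and q: "q \<in> up R" and pq: "p \<otimes>\<^bsub>S\<^esub> q = \<one>\<^bsub>S\<^esub>"
    and n: "n \<ge> 1" and above: "\<And>i. i > n \<Longrightarrow> p i \<in> N"
  shows "p n \<otimes> q j \<in> N"
proof -
  note [simp] = mem_upD[OF p] mem_upD[OF q]
  obtain m where m: "bound \<zero> m q" using q by (auto simp: up_def)
  show ?thesis
  proof (induction "m - j" arbitrary: j rule: less_induct)
    \<comment> \<open>The descent starts beyond the degree bound \<open>m\<close> of
      \<open>q\<close>, where coefficients are zero; \<open>big\<close> collects the indices already
      settled.\<close>
    case less
    have big: "p n \<otimes> q j' \<in> N" if "j' > j" for j'
    proof (cases "j' \<le> m")
      case True
      then show ?thesis using less that by simp
    next
      case False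
      then show ?thesis using bound.bound[OF m, of j'] N.zero_closed by simp
    qed
    define t where "t i = p n \<otimes> (p i \<otimes> (\<alpha> ^^ i) (q (n + j - i)))" for i
    have "(\<Oplus>i\<in>{..n + j}. p i \<otimes> (\<alpha> ^^ i) (q (n + j - i))) = \<zero>"
      using fun_cong[OF pq, of "n + j"] n p q by (simp add: skew_UP_simps)
    then have sum: "(\<Oplus>i\<in>{..n + j}. t i) = \<zero>"
      using finsum_rdistr[of "{..n + j}" "p n" "\<lambda>i. p i \<otimes> (\<alpha> ^^ i) (q (n + j - i))"]
      by (simp add: t_def Pi_def)
    have "t i \<in> N" if i: "i \<in> {..n + j}" "i \<noteq> n" for i
    proof (cases "i < n")
      case True
      let ?b = "q (n + j - i)"
      \<comment> \<open>The index of \<open>?b\<close> exceeds \<open>j\<close>, so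
        \<open>big\<close> applies. Commuting factors modulo \<open>N\<close> makes room for
        \<open>p i\<close> between \<open>p n\<close> and \<open>?b\<close>.\<close>
      have "?b \<otimes> p n \<in> N" using nilpotents_mult_commute[OF _ _ big] True by simp
      then have "?b \<otimes> p n \<otimes> p i \<in> N" using N.I_r_closed by simp
      then have "?b \<otimes> (p n \<otimes> p i) \<in> N" by (simp add: m_assoc)
      then have "(p n \<otimes> p i) \<otimes> ?b \<in> N" by (intro nilpotents_mult_commute[of ?b]) auto
      then have "(p n \<otimes> p i) \<otimes> (\<alpha> ^^ i) ?b \<in> N" using mult_funpow_nilpotent_iff by simp
      then show ?thesis by (simp add: t_def m_assoc)
    next
      case False
      then have "p i \<in> N" using above i by simp
      then show ?thesis unfolding t_def by (intro N.I_l_closed N.I_r_closed) auto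
    qed
    then have "t n \<in> N"
      using finsum_zero_remaining_mem[OF N.is_additive_subgroup _ _ _ sum, of n]
      by (auto simp: t_def)
    \<comment> \<open>Only the term \<open>i = n\<close> was left. Remove the power of \<alpha>,
      then one of the two factors \<open>p n\<close>.\<close>
    then have "(p n \<otimes> p n) \<otimes> (\<alpha> ^^ n) (q j) \<in> N" by (simp add: t_def m_assoc)
    then have "p n \<otimes> (p n \<otimes> q j) \<in> N"
      using mult_funpow_nilpotent_iff[of "p n \<otimes> p n" "q j"] by (simp add: m_assoc)
    then show ?case by (rule mult_nilpotent_if_square_mult[rotated 2]) simp_all
  qed
qed

text \<open>Constant terms multiply, so \<open>p 0\<close> is invertible with inverse
  \<open>q 0\<close>. At the largest \<open>n \<ge> 1\<close> with \<open>p n\<close> outside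
  \<open>N\<close>, the product \<open>p n \<otimes> q 0\<close> lies in \<open>N\<close>;
  multiplying by \<open>p 0\<close> gives a contradiction.\<close>

lemma Units_skew_UP_coeffs:
  assumes "p \<in> Units S"
  shows "p 0 \<in> Units R" "i \<ge> 1 \<Longrightarrow> p i \<in> N"
proof -
  obtain q where up: "p \<in> up R" "q \<in> up R"
    and pq: "p \<otimes>\<^bsub>S\<^esub> q = \<one>\<^bsub>S\<^esub>" and qp: "q \<otimes>\<^bsub>S\<^esub> p = \<one>\<^bsub>S\<^esub>"
    using assms by (auto simp: Units_def skew_UP_simps(1))
  have pq0: "p 0 \<otimes> q 0 = \<one>" using fun_cong[OF pq, of 0] S_mult_0 up by (simp add: skew_UP_simps(2))
  have qp0: "q 0 \<otimes> p 0 = \<one>" using fun_cong[OF qp, of 0] S_mult_0 up by (simp add: skew_UP_simps(2))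
  show "p 0 \<in> Units R"
    using pq0 qp0 up by (intro UnitsI_inverses[of _ "q 0" "q 0"]) (auto simp: mem_upD)
  obtain m where m: "bound \<zero> m p" using up by (auto simp: up_def)
  define B where "B = {i. i \<ge> 1 \<and> p i \<notin> N}"
  have "B \<subseteq> {..m}"
    using bound.bound[OF m] N.zero_closed by (force simp: B_def not_le[symmetric])
  then have fin: "finite B" by (rule finite_subset) simp
  have "B = {}"
  proof (rule ccontr)
    assume ne: "B \<noteq> {}"
    define n where "n = Max B"
    have n: "n \<ge> 1" "p n \<notin> N" using Max_in[OF fin ne] by (auto simp: n_def B_def)
    have "p i \<in> N" if "i > n" for i
      using Max_ge[OF fin, of i] that n(1) by (force simp: n_def B_def)
    then have "p n \<otimes> q 0 \<in> N" using leading_coeff_annihilates up pq n(1) by blast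
    then have "p n \<otimes> q 0 \<otimes> p 0 \<in> N" using N.I_r_closed up by (simp add: mem_upD)
    then show False using n(2) up qp0 by (simp add: m_assoc mem_upD)
  qed
  then show "i \<ge> 1 \<Longrightarrow> p i \<in> N" by (auto simp: B_def)
qed

section \<open>Constant polynomials and the transfer of unit conditions\<close>

lemma monom_closed: "a \<in> carrier R \<Longrightarrow> monom S a n \<in> carrier S"
  using monom_up[of a n] by (simp add: skew_UP_simps)

lemma const_mult:
  "\<lbrakk>a \<in> carrier R; b \<in> carrier R\<rbrakk> \<Longrightarrow> monom S a 0 \<otimes>\<^bsub>S\<^esub> monom S b 0 = monom S (a \<otimes> b) 0"
  using skew_UP_monom_mult[OF hom, of a b 0 0] by simp

lemma const_one: "monom S \<one> 0 = \<one>\<^bsub>S\<^esub>"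
  by (simp add: skew_UP_simps)

lemma const_pow: "a \<in> carrier R \<Longrightarrow> monom S a 0 [^]\<^bsub>S\<^esub> (k::nat) = monom S (a [^] k) 0"
  by (induction k) (simp_all add: const_mult const_one)

lemma const_Units: "u \<in> Units R \<Longrightarrow> monom S u 0 \<in> Units S"
  by (rule S.UnitsI_inverses[of _ "monom S (inv u) 0" "monom S (inv u) 0"])
    (simp_all add: monom_closed const_mult const_one Units_closed)

lemma nilpotent_if_const_J_sharp:
  assumes c: "c \<in> carrier R" and J: "monom S c 0 \<in> J_sharp S"
  shows "c \<in> N"
proof -
  obtain k :: nat where k: "k \<ge> 1" "monom S (c [^] k) 0 \<in> jacobson_radical S"
    using J c by (auto simp: J_sharp_def const_pow)
  let ?a = "c [^] k"
  have a: "?a \<in> carrier R" "\<alpha> ?a \<in> carrier R" using c funpow_closed[of ?a 1] by auto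
  have "monom S \<one> 1 \<otimes>\<^bsub>S\<^esub> monom S ?a 0 \<in> jacobson_radical S"
    using S.jacobsonD(4) k monom_closed by blast
  then have "monom S (\<alpha> ?a) 1 \<in> jacobson_radical S"
    using skew_UP_monom_mult[OF hom, of \<one> ?a 1 0] a by simp
  then have "\<one>\<^bsub>S\<^esub> \<oplus>\<^bsub>S\<^esub> monom S (\<alpha> ?a) 1 \<in> Units S" by (rule S.one_plus_jacobson_Units)
  then have "(\<one>\<^bsub>S\<^esub> \<oplus>\<^bsub>S\<^esub> monom S (\<alpha> ?a) 1) 1 \<in> N" by (rule Units_skew_UP_coeffs) simp
  then have "\<alpha> ?a \<in> N"
    using a monom_closed[OF a(2), of 1] S.one_closed by (simp add: skew_UP_simps)
  then have "?a \<in> N" using mult_funpow_nilpotent_iff[of \<one> ?a 1] a by simp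
  then show ?thesis using nilpotents_power_iff c k(1) by blast
qed

lemma UU_ring_iff_Units_skew_UP:
  assumes X: "nil_polys \<subseteq> X" "X \<subseteq> J_sharp S"
  shows "UU_ring R \<longleftrightarrow> Units S = \<one>\<^bsub>S\<^esub> <+\<^bsub>S\<^esub> X"
proof
  assume UU: "UU_ring R"
  have "p \<in> \<one>\<^bsub>S\<^esub> <+\<^bsub>S\<^esub> X" if p: "p \<in> Units S" for p
  proof -
    have up: "p \<in> up R" using S.Units_closed[OF p] by (simp add: skew_UP_simps)
    obtain c where c: "c \<in> N" "p 0 = \<one> \<oplus> c"
      using UU Units_skew_UP_coeffs(1)[OF p] by (auto simp: UU_ring_def a_l_coset_def')
    define h where "h i = (if i = 0 then c else p i)" for i
    obtain m where m: "bound \<zero> m p" using up by (auto simp: up_def)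
    have h: "h \<in> nil_polys"
    proof -
      have "h \<in> up R"
        using up c bound.bound[OF m] N.a_Hcarr
        by (intro mem_upI exI[of _ m]) (auto simp: h_def mem_upD)
      then show ?thesis using Units_skew_UP_coeffs(2)[OF p] c by (auto simp: nil_polys_def h_def)
    qed
    then have "p = \<one>\<^bsub>S\<^esub> \<oplus>\<^bsub>S\<^esub> h"
      using S.one_closed up c by (auto simp: nil_polys_def skew_UP_simps h_def mem_upD)
    then show ?thesis using X h by (auto simp: a_l_coset_def')
  qed
  moreover have "\<one>\<^bsub>S\<^esub> <+\<^bsub>S\<^esub> X \<subseteq> Units S"
    using S.one_plus_J_sharp_Units X(2) by (auto simp: a_l_coset_def')
  ultimately show "Units S = \<one>\<^bsub>S\<^esub> <+\<^bsub>S\<^esub> X" by blast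
next
  assume U: "Units S = \<one>\<^bsub>S\<^esub> <+\<^bsub>S\<^esub> X"
  have "u \<in> \<one> <+ N" if u: "u \<in> Units R" for u
  proof -
    have uc: "u \<in> carrier R" using u by (rule Units_closed)
    define c where "c = \<ominus> \<one> \<oplus> u"
    have c: "c \<in> carrier R" "u = \<one> \<oplus> c" using uc by (simp_all add: c_def r_neg2)
    obtain z where z: "z \<in> X" "monom S u 0 = \<one>\<^bsub>S\<^esub> \<oplus>\<^bsub>S\<^esub> z"
      using const_Units[OF u] U by (auto simp: a_l_coset_def')
    have "monom S u 0 = \<one>\<^bsub>S\<^esub> \<oplus>\<^bsub>S\<^esub> monom S c 0"
      using c uc monom_closed[of c 0] S.one_closed by (auto simp: skew_UP_simps)
    moreover have "z \<in> carrier S" using z X by (auto simp: J_sharp_def)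
    ultimately have "z = monom S c 0" using z c monom_closed by simp
    then have "c \<in> N" using nilpotent_if_const_J_sharp c z X by blast
    then show ?thesis using c(2) by (auto simp: a_l_coset_def')
  qed
  moreover have "\<one> <+ N \<subseteq> Units R"
    using one_plus_J_sharp_Units nilpotents_subset_J_sharp by (auto simp: a_l_coset_def')
  ultimately show "UU_ring R" by (auto simp: UU_ring_def)
qed

end

theorem theorem3p16:
  fixes R :: "('a, 'b) ring_scheme" and \<alpha> :: "'a \<Rightarrow> 'a"
  assumes "ring R"
    and "two_primal R"
    and "\<alpha> \<in> ring_hom R R"
    and "compatible R \<alpha>"
  shows "(UU_ring R \<longleftrightarrow> UJ_sharp_ring (skew_UP R \<alpha>)) \<and>
         (UJ_sharp_ring (skew_UP R \<alpha>) \<longleftrightarrow> UJ_ring (skew_UP R \<alpha>)) \<and>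
         (UJ_ring (skew_UP R \<alpha>) \<longleftrightarrow> UU_ring (skew_UP R \<alpha>))"
proof -
  interpret compatible_two_primal_ring R \<alpha>
    using assms by (simp add: compatible_two_primal_ring_def compatible_two_primal_ring_axioms_def)
  have "UU_ring R \<longleftrightarrow> UJ_sharp_ring S"
    unfolding UJ_sharp_ring_def
    using nil_polys_subset_jacobson S.jacobson_subset_J_sharp
    by (intro UU_ring_iff_Units_skew_UP) auto
  moreover have "UU_ring R \<longleftrightarrow> UJ_ring S"
    unfolding UJ_ring_def
    using nil_polys_subset_jacobson S.jacobson_subset_J_sharp by (rule UU_ring_iff_Units_skew_UP)
  moreover have "UU_ring R \<longleftrightarrow> UU_ring S"
    unfolding UU_ring_def[of S]
    using nil_polys_nilpotent S.nilpotents_subset_J_sharp by (rule UU_ring_iff_Units_skew_UP)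
  ultimately show ?thesis by blast
qed

end
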